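(* Let $T:c_{0}\times c_{0}\to\mathbb{C}$ be given by $T(z,w)=\sum_{i,j=1}^{2}a_{ij}z_{i}w_{j}$ with $a_{ij}\in\mathbb{R}$. Then: (A) If $(a_{11},a_{21},a_{12},a_{22})\in(\mathbb{R}\setminus\{0\})^{4}$, $\operatorname{sgn}\left(\frac{a_{11}a_{21}}{a_{12}a_{22}}\right)=-1$ and $$\left|\frac{a_{11}^{2}a_{21}^{2}}{a_{12}^{2}a_{22}^{2}}\left(a_{12}^{2}+a_{22}^{2}\right)-\left(a_{11}^{2}+a_{21}^{2}\right)\right|\leq\left|2a_{11}a_{21}\left(1-\frac{a_{11}a_{21}}{a_{12}a_{22}}\right)\right|,$$ then, writing $$\kappa=\frac{\frac{a_{11}^{2}a_{21}^{2}}{a_{12}^{2}a_{22}^{2}}(a_{12}^{2}+a_{22}^{2})-(a_{11}^{2}+a_{21}^{2})}{2a_{11}a_{21}\left(1-\frac{a_{11}a_{21}}{a_{12}a_{22}}\right)},$$ one has $$\|T\|=\max\left\{\begin{array}{c}|a_{11}+a_{21}|+|a_{12}+a_{22}|,\quad |a_{11}-a_{21}|+|a_{12}-a_{22}|,\\ \sqrt{a_{11}^{2}+a_{21}^{2}+2a_{11}a_{21}\kappa}+\sqrt{a_{12}^{2}+a_{22}^{2}+2a_{12}a_{22}\kappa}\end{array}\right\}.$$ (B) Otherwise, $$\|T\|=\max\left\{|a_{11}+a_{21}|+|a_{12}+a_{22}|,\ |a_{11}-a_{21}|+|a_{12}-a_{22}|\right\}.$$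
   Context: Here $c_0$ is the complex Banach space of complex sequences $z=(z_n)_{n\ge1}$ converging to $0$ with the sup norm, and $\|T\|=\sup\{|T(z,w)|:\|z\|_\infty\le 1,\|w\|_\infty\le 1\}$. $\operatorname{sgn}$ is the sign function. *)

theory Defs
  imports "HOL-Analysis.Analysis"
begin

text \<open>
  The type \<^typ>\<open>nat \<Rightarrow>\<^sub>C complex\<close> is the space of all bounded complex sequences with the sup norm
  (every function on the discrete space \<^typ>\<open>nat\<close> is continuous); \<open>c0\<close> is its subspace of null
  sequences.
\<close>

definition c0 :: "(nat \<Rightarrow>\<^sub>C complex) set" where
  "c0 = {z. (\<lambda>n. apply_bcontfun z n) \<longlonglongrightarrow> 0}"

text \<open>
  Sequences \<open>(z\<^sub>n)\<close> with \<open>n \<ge> 1\<close> are stored from index 0 on, so the entry \<open>z\<^sub>n\<close> sits at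
  position \<open>n - 1\<close>. Only indices \<open>n \<ge> 1\<close> are meaningful.
\<close>

definition coord :: "(nat \<Rightarrow>\<^sub>C complex) \<Rightarrow> nat \<Rightarrow> complex" where
  "coord z n = apply_bcontfun z (n - 1)"

definition bilinear_norm :: "((nat \<Rightarrow>\<^sub>C complex) \<Rightarrow> (nat \<Rightarrow>\<^sub>C complex) \<Rightarrow> complex) \<Rightarrow> real" where
  "bilinear_norm T = Sup {cmod (T z w) | z w. z \<in> c0 \<and> w \<in> c0 \<and> norm z \<le> 1 \<and> norm w \<le> 1}"

end

theory Submission
  imports Defs
begin

text \<open>
  For fixed \<open>z\<close> the best \<open>w\<close> rotates both columns to the positive axis, so \<open>\<parallel>T\<parallel>\<close> is the supremum of
  \<open>|a\<^sub>1\<^sub>1 z\<^sub>1 + a\<^sub>2\<^sub>1 z\<^sub>2| + |a\<^sub>1\<^sub>2 z\<^sub>1 + a\<^sub>2\<^sub>2 z\<^sub>2|\<close>. Every point of the closed unit disc is the midpoint of two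
  unimodular numbers, so by convexity only \<open>|z\<^sub>1| = |z\<^sub>2| = 1\<close> matters, and there the expression depends
  only on \<open>t = Re (z\<^sub>1 cnj z\<^sub>2)\<close>: it is the concave function \<open>\<surd>(P + p t) + \<surd>(Q + q t)\<close> on \<open>[-1, 1]\<close>, where
  \<open>P\<close>, \<open>Q\<close> are the sums of squares of the columns and \<open>p\<close>, \<open>q\<close> twice the products of their entries.
  If \<open>p q < 0\<close>, its only possible critical point is \<open>\<kappa>\<close>; otherwise it is monotone.
\<close>

section \<open>Maximising a sum of two square roots of affine functions\<close>

lemma sqrt_le_tangent:
  fixes x y :: real
  assumes "x > 0" "y \<ge> 0"
  shows "sqrt y \<le> sqrt x + (y - x) / (2 * sqrt x)"
proof -
  have "0 \<le> (sqrt y - sqrt x)\<^sup>2" by simp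
  then have "2 * sqrt x * sqrt y \<le> x + y"
    using assms by (simp add: power2_diff algebra_simps)
  moreover have "sqrt x * sqrt x = x" using assms by simp
  ultimately have "2 * sqrt x * sqrt y \<le> 2 * sqrt x * sqrt x + (y - x)" by linarith
  then show ?thesis using assms by (simp add: field_simps)
qed

text \<open>The sign hypothesis says that the derivative at \<open>s\<close> of the right-hand side points away from \<open>t\<close>.\<close>

lemma sqrt_sum_le_of_derivative_sign:
  fixes p q P Q s t :: real
  assumes pq: "p > 0" "q < 0"
    and pos: "P + p * s > 0" "Q + q * s > 0"
    and nonneg: "P + p * t \<ge> 0" "Q + q * t \<ge> 0"
    and sign: "(p\<^sup>2 * (Q + q * s) - q\<^sup>2 * (P + p * s)) * (t - s) \<le> 0"
  shows "sqrt (P + p * t) + sqrt (Q + q * t) \<le> sqrt (P + p * s) + sqrt (Q + q * s)"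
proof -
  define A where "A = sqrt (P + p * s)"
  define B where "B = sqrt (Q + q * s)"
  have AB: "A > 0" "B > 0" using pos by (simp_all add: A_def B_def)
  have sq: "A\<^sup>2 = P + p * s" "B\<^sup>2 = Q + q * s" using pos by (simp_all add: A_def B_def)
  have 1: "sqrt (P + p * t) \<le> A + p * (t - s) / (2 * A)"
    using sqrt_le_tangent[OF pos(1) nonneg(1)] by (simp add: A_def algebra_simps)
  have 2: "sqrt (Q + q * t) \<le> B + q * (t - s) / (2 * B)"
    using sqrt_le_tangent[OF pos(2) nonneg(2)] by (simp add: B_def algebra_simps)
  \<comment> \<open>The sign hypothesis is a difference of squares. Its factor
    \<open>p * B - q * A\<close> is positive, so \<open>p * B + q * A\<close> carries the sign; it
    is the numerator of the derivative \<open>p / (2 * A) + q / (2 * B)\<close> at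
    \<open>s\<close>.\<close>
  have "(p * B - q * A) * ((p * B + q * A) * (t - s)) \<le> 0"
    using sign unfolding sq[symmetric] by (simp add: algebra_simps power2_eq_square)
  moreover have "p * B - q * A > 0"
    using pq AB by (simp add: add_pos_pos mult_neg_pos less_trans[of _ 0])
  ultimately have "(p * B + q * A) * (t - s) \<le> 0"
    by (simp add: mult_le_0_iff)
  then have "(p * B + q * A) * (t - s) / (2 * A * B) \<le> 0"
    using AB by (simp add: divide_nonpos_pos)
  moreover have "p * (t - s) / (2 * A) + q * (t - s) / (2 * B) = (p * B + q * A) * (t - s) / (2 * A * B)"
    using AB by (simp add: field_simps)
  ultimately show ?thesis using 1 2 unfolding A_def B_def by linarith
qed

lemma abs_mult_le_imp_add_nonneg:
  fixes p P t :: real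
  assumes "\<bar>p\<bar> \<le> P" "\<bar>t\<bar> \<le> 1"
  shows "P + p * t \<ge> 0"
proof -
  have "\<bar>p * t\<bar> \<le> \<bar>p\<bar>" using assms(2) by (simp add: abs_mult mult_left_le)
  then show ?thesis using assms(1) by linarith
qed

text \<open>A critical point of a concave function is a global maximum. The equation
  \<open>crit\<close> is the vanishing of the derivative, squared; as \<open>p\<close> and
  \<open>q\<close> have opposite signs, squaring adds no spurious root. The result is affine in
  \<open>s\<close>, hence solvable in closed form.\<close>

lemma sqrt_sum_le_critical_value:
  fixes p q P Q s t :: real
  assumes pq: "p * q < 0" and P: "\<bar>p\<bar> \<le> P" and Q: "\<bar>q\<bar> \<le> Q"
    and s: "\<bar>s\<bar> \<le> 1" and t: "\<bar>t\<bar> \<le> 1"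
    and crit: "p\<^sup>2 * (Q + q * s) = q\<^sup>2 * (P + p * s)"
  shows "sqrt (P + p * t) + sqrt (Q + q * t) \<le> sqrt (P + p * s) + sqrt (Q + q * s)"
proof -
  note nn = abs_mult_le_imp_add_nonneg[OF P t] abs_mult_le_imp_add_nonneg[OF Q t]
  have nz: "p \<noteq> 0" "q \<noteq> 0" using pq by auto
  have "P * Q > 0" using P Q nz by (intro mult_pos_pos) auto
  \<comment> \<open>The tangents at \<open>s\<close> exist only if both radicands are positive. By
    \<open>crit\<close> they vanish together, and joint vanishing would make \<open>P * Q\<close>
    nonpositive.\<close>
  have "\<not> (P + p * s = 0 \<and> Q + q * s = 0)"
  proof
    assume "P + p * s = 0 \<and> Q + q * s = 0"
    then have "P = - (p * s)" "Q = - (q * s)" by linarith+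
    then have "P * Q = (p * q) * s\<^sup>2" by (simp add: power2_eq_square)
    also have "\<dots> \<le> 0" using pq by (simp add: mult_nonpos_nonneg)
    finally show False using \<open>P * Q > 0\<close> by simp
  qed
  moreover have "P + p * s = 0 \<longleftrightarrow> Q + q * s = 0"
    using crit nz by auto
  ultimately have pos: "P + p * s > 0" "Q + q * s > 0"
    using abs_mult_le_imp_add_nonneg[OF P s] abs_mult_le_imp_add_nonneg[OF Q s] by linarith+
  consider "p > 0" "q < 0" | "p < 0" "q > 0"
    using pq by (auto simp: mult_less_0_iff)
  then show ?thesis
  proof cases
    case 1
    then show ?thesis by (rule sqrt_sum_le_of_derivative_sign[OF _ _ pos nn]) (simp add: crit)
  next
    case 2
    then show ?thesis
      using sqrt_sum_le_of_derivative_sign[of q p Q s P t] pos nn crit by simp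
  qed
qed

text \<open>The derivative at \<open>t\<close> has the sign of the affine function
  \<open>(p^2 * Q - q^2 * P) + p * q * (p - q) * t\<close>. By \<open>nocrit\<close> its constant
  term dominates on [-1, 1], so it has no zero there and the maximum sits at an endpoint.\<close>

lemma sqrt_sum_le_endpoints_pos_neg:
  fixes p q P Q t :: real
  assumes pq: "p > 0" "q < 0" and P: "\<bar>p\<bar> \<le> P" and Q: "\<bar>q\<bar> \<le> Q" and t: "\<bar>t\<bar> \<le> 1"
    and nocrit: "\<bar>p * q * (p - q)\<bar> < \<bar>p\<^sup>2 * Q - q\<^sup>2 * P\<bar>"
  shows "sqrt (P + p * t) + sqrt (Q + q * t) \<le> max (sqrt (P + p) + sqrt (Q + q)) (sqrt (P - p) + sqrt (Q - q))"
proof -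
  note nn = abs_mult_le_imp_add_nonneg[OF P t] abs_mult_le_imp_add_nonneg[OF Q t]
  have neg: "p * q * (p - q) < 0" using pq by (intro mult_neg_pos mult_pos_neg) auto
  consider "p\<^sup>2 * (Q + q) - q\<^sup>2 * (P + p) > 0" | "p\<^sup>2 * (Q - q) - q\<^sup>2 * (P - p) < 0"
  proof -
    have "p\<^sup>2 * (Q + q) - q\<^sup>2 * (P + p) = (p\<^sup>2 * Q - q\<^sup>2 * P) + p * q * (p - q)"
         "p\<^sup>2 * (Q - q) - q\<^sup>2 * (P - p) = (p\<^sup>2 * Q - q\<^sup>2 * P) - p * q * (p - q)"
      by algebra+
    then show ?thesis using nocrit neg that by linarith
  qed
  then show ?thesis
  proof cases
    case 1
    \<comment> \<open>Since \<open>q < 0\<close>, the radicand \<open>Q + q\<close> might vanish;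
      the strict sign in this case excludes that.\<close>
    have "q\<^sup>2 * (P + p) \<ge> 0" using P by (intro mult_nonneg_nonneg) auto
    then have "p\<^sup>2 * (Q + q) > 0" using 1 by linarith
    then have "Q + q > 0" using pq by (simp add: zero_less_mult_iff)
    moreover have "P + p > 0" using P pq by linarith
    moreover have "(p\<^sup>2 * (Q + q) - q\<^sup>2 * (P + p)) * (t - 1) \<le> 0"
      using 1 t by (intro mult_nonneg_nonpos) auto
    ultimately show ?thesis
      using sqrt_sum_le_of_derivative_sign[of p q P 1 Q t] pq nn by simp
  next
    case 2
    have "p\<^sup>2 * (Q - q) \<ge> 0" using Q by (intro mult_nonneg_nonneg) auto
    then have "q\<^sup>2 * (P - p) > 0" using 2 by linarith
    then have "P - p > 0" using pq by (simp add: zero_less_mult_iff)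
    moreover have "Q - q > 0" using Q pq by linarith
    moreover have "(p\<^sup>2 * (Q - q) - q\<^sup>2 * (P - p)) * (t + 1) \<le> 0"
      using 2 t by (intro mult_nonpos_nonneg) auto
    ultimately show ?thesis
      using sqrt_sum_le_of_derivative_sign[of p q P "-1" Q t] pq nn by simp
  qed
qed

text \<open>When \<open>p\<close> and \<open>q\<close> do not have opposite signs, both roots are
  monotone in the same direction; this is why \<open>nocrit\<close> is conditional.\<close>

lemma sqrt_sum_le_endpoints:
  fixes p q P Q t :: real
  assumes P: "\<bar>p\<bar> \<le> P" and Q: "\<bar>q\<bar> \<le> Q" and t: "\<bar>t\<bar> \<le> 1"
    and nocrit: "p * q < 0 \<Longrightarrow> \<bar>p * q * (p - q)\<bar> < \<bar>p\<^sup>2 * Q - q\<^sup>2 * P\<bar>"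
  shows "sqrt (P + p * t) + sqrt (Q + q * t) \<le> max (sqrt (P + p) + sqrt (Q + q)) (sqrt (P - p) + sqrt (Q - q))"
proof -
  have t': "t \<le> 1" "- 1 \<le> t" using t by auto
  consider "p \<ge> 0" "q \<ge> 0" | "p \<le> 0" "q \<le> 0" | "p > 0" "q < 0" | "p < 0" "q > 0"
    by linarith
  then show ?thesis
  proof cases
    case 1
    then have "p * t \<le> p" "q * t \<le> q" using t' by (simp_all add: mult_left_le)
    then have "sqrt (P + p * t) + sqrt (Q + q * t) \<le> sqrt (P + p) + sqrt (Q + q)"
      by (intro add_mono real_sqrt_le_mono) auto
    then show ?thesis by simp
  next
    case 2
    then have "p * t \<le> - p" "q * t \<le> - q"
      using mult_left_mono_neg[of "-1" t p] mult_left_mono_neg[of "-1" t q] t' by auto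
    then have "sqrt (P + p * t) + sqrt (Q + q * t) \<le> sqrt (P - p) + sqrt (Q - q)"
      by (intro add_mono real_sqrt_le_mono) auto
    then show ?thesis by simp
  next
    case 3
    then show ?thesis
      using nocrit by (intro sqrt_sum_le_endpoints_pos_neg P Q t) (auto simp: mult_pos_neg)
  next
    case 4
    then have "\<bar>p * q * (p - q)\<bar> < \<bar>p\<^sup>2 * Q - q\<^sup>2 * P\<bar>" using nocrit by (simp add: mult_neg_pos)
    moreover have "\<bar>q * p * (q - p)\<bar> = \<bar>p * q * (p - q)\<bar>"
      by (simp add: abs_mult abs_minus_commute)
    moreover have "\<bar>q\<^sup>2 * P - p\<^sup>2 * Q\<bar> = \<bar>p\<^sup>2 * Q - q\<^sup>2 * P\<bar>" by (rule abs_minus_commute)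
    ultimately show ?thesis
      using sqrt_sum_le_endpoints_pos_neg[of q p Q P t] 4 P Q t by (simp add: add.commute)
  qed
qed

section \<open>Reduction to unimodular coordinates\<close>

text \<open>The chord through \<open>z\<close> perpendicular to the radius is bisected by
  \<open>z\<close>; its ends are \<open>u\<close> and \<open>v\<close>.\<close>

lemma unit_disc_midpoint:
  fixes z :: complex
  assumes "cmod z \<le> 1"
  obtains u v where "cmod u = 1" "cmod v = 1" "z = (u + v) / 2"
proof -
  define r where "r = cmod z"
  \<comment> \<open>\<open>sgn 0\<close> is 0, so the direction at the origin is set to 1 to remain
    unimodular.\<close>
  define e where "e = (if z = 0 then 1 else sgn z)"
  have e: "cmod e = 1" by (simp add: e_def norm_sgn)
  have z: "z = e * of_real r" by (auto simp: e_def r_def sgn_eq)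
  define h where "h = sqrt (1 - r\<^sup>2)"
  have "r\<^sup>2 \<le> 1" using assms by (simp add: r_def power_le_one)
  then have h: "r\<^sup>2 + h\<^sup>2 = 1" by (simp add: h_def)
  show ?thesis
  proof
    show "cmod (e * Complex r h) = 1" "cmod (e * Complex r (- h)) = 1"
      using e h by (simp_all add: norm_mult complex_norm)
    have "Complex r h + Complex r (- h) = 2 * of_real r" by (simp add: complex_eq_iff)
    then have "e * Complex r h + e * Complex r (- h) = e * (2 * of_real r)"
      by (metis distrib_left)
    then show "z = (e * Complex r h + e * Complex r (- h)) / 2" using z by simp
  qed
qed

text \<open>Law of cosines: only the angle between \<open>u\<close> and \<open>v\<close> matters, so
  a single real parameter remains.\<close>

lemma cmod_real_combination_unit:
  fixes a b :: real and u v :: complex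
  assumes "cmod u = 1" "cmod v = 1"
  shows "cmod (of_real a * u + of_real b * v) = sqrt (a\<^sup>2 + b\<^sup>2 + 2 * a * b * Re (u * cnj v))"
proof -
  have "(Re u)\<^sup>2 + (Im u)\<^sup>2 = 1" "(Re v)\<^sup>2 + (Im v)\<^sup>2 = 1"
    using assms by (simp_all add: cmod_def)
  then have "(a * Re u + b * Re v)\<^sup>2 + (a * Im u + b * Im v)\<^sup>2
      = a\<^sup>2 + b\<^sup>2 + 2 * a * b * (Re u * Re v + Im u * Im v)"
    by algebra
  then show ?thesis by (simp add: cmod_def)
qed

lemma cmod_combination_midpoint:
  fixes \<alpha> \<beta> u v x y :: complex
  assumes "x = (u + v) / 2"
  shows "2 * cmod (\<alpha> * x + \<beta> * y) \<le> cmod (\<alpha> * u + \<beta> * y) + cmod (\<alpha> * v + \<beta> * y)"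
proof -
  have "(\<alpha> * u + \<beta> * y) + (\<alpha> * v + \<beta> * y) = 2 * (\<alpha> * x + \<beta> * y)"
    using assms by (simp add: field_simps)
  then have "2 * cmod (\<alpha> * x + \<beta> * y) = cmod ((\<alpha> * u + \<beta> * y) + (\<alpha> * v + \<beta> * y))"
    by (simp only: norm_mult norm_numeral)
  also have "\<dots> \<le> cmod (\<alpha> * u + \<beta> * y) + cmod (\<alpha> * v + \<beta> * y)"
    by (rule norm_triangle_ineq)
  finally show ?thesis .
qed

text \<open>The sum is convex in each variable separately: averaging over the ends of a chord frees
  first \<open>x\<close>, then \<open>y\<close>, from the unit circle.\<close>

lemma cmod_sum_le_on_unit_bidisc:
  fixes a b c d :: complex and M :: real
  assumes unit: "\<And>u v. cmod u = 1 \<Longrightarrow> cmod v = 1 \<Longrightarrow> cmod (a * u + b * v) + cmod (c * u + d * v) \<le> M"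
    and x: "cmod x \<le> 1" and y: "cmod y \<le> 1"
  shows "cmod (a * x + b * y) + cmod (c * x + d * y) \<le> M"
proof -
  have half: "cmod (a * x + b * v) + cmod (c * x + d * v) \<le> M" if v: "cmod v = 1" for v
  proof -
    obtain u1 u2 where u: "cmod u1 = 1" "cmod u2 = 1" "x = (u1 + u2) / 2"
      using unit_disc_midpoint[OF x] .
    show ?thesis
      using unit[OF u(1) v] unit[OF u(2) v]
        cmod_combination_midpoint[OF u(3), of a b v] cmod_combination_midpoint[OF u(3), of c d v]
      by linarith
  qed
  obtain v1 v2 where v: "cmod v1 = 1" "cmod v2 = 1" "y = (v1 + v2) / 2"
    using unit_disc_midpoint[OF y] .
  show ?thesis
    using half[OF v(1)] half[OF v(2)]
      cmod_combination_midpoint[OF v(3), of b a x] cmod_combination_midpoint[OF v(3), of d c x]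
    unfolding add.commute[of "b * _"] add.commute[of "d * _"] by linarith
qed

section \<open>The norm as a one-variable maximum\<close>

lemma c0_unit_ball_witness:
  fixes x y :: complex
  assumes "cmod x \<le> 1" "cmod y \<le> 1"
  obtains z where "z \<in> c0" "norm z \<le> 1" "coord z 1 = x" "coord z 2 = y"
proof -
  \<comment> \<open>Positions 0 and 1 hold the entries that \<open>coord\<close> reads at 1 and
    2.\<close>
  define g :: "nat \<Rightarrow> complex" where "g = (\<lambda>n. if n = 0 then x else if n = 1 then y else 0)"
  have g: "cmod (g n) \<le> 1" for n using assms by (simp add: g_def)
  have "g \<in> bcontfun"
    using g by (auto simp: bcontfun_def bounded_iff)
  then have app: "apply_bcontfun (Bcontfun g) = g" by (rule Bcontfun_inverse)
  show ?thesis
  proof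
    have "\<forall>\<^sub>F n in sequentially. g n = 0"
      using eventually_ge_at_top[of 2] by eventually_elim (simp add: g_def)
    then show "Bcontfun g \<in> c0" unfolding c0_def by (simp add: app tendsto_eventually)
    show "norm (Bcontfun g) \<le> 1" using g by (intro norm_bound) (simp add: app)
    show "coord (Bcontfun g) 1 = x" "coord (Bcontfun g) 2 = y"
      by (simp_all add: coord_def app, simp_all add: g_def)
  qed
qed

text \<open>Supplies the entries of \<open>w\<close> that make both summands of \<open>T z w\<close>
  nonnegative reals, so that the triangle inequality becomes an equality.\<close>

lemma rotation_to_cmod:
  fixes s :: complex
  obtains e where "cmod e = 1" "s * e = of_real (cmod s)"
proof (cases "s = 0")
  case True
  then show ?thesis using that[of 1] by simp
next
  case False
  then have "s * (cnj s / of_real (cmod s)) = of_real (cmod s)"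
    by (simp add: complex_norm_square[symmetric] power2_eq_square)
  moreover have "cmod (cnj s / of_real (cmod s)) = 1" using False by (simp add: norm_divide)
  ultimately show ?thesis using that by blast
qed

lemma bilinear_norm_eqI:
  fixes a :: "nat \<Rightarrow> nat \<Rightarrow> real" and M :: real
  defines "f \<equiv> \<lambda>t. sqrt ((a 1 1)\<^sup>2 + (a 2 1)\<^sup>2 + 2 * a 1 1 * a 2 1 * t)
      + sqrt ((a 1 2)\<^sup>2 + (a 2 2)\<^sup>2 + 2 * a 1 2 * a 2 2 * t)"
  assumes T: "\<And>z w. z \<in> c0 \<Longrightarrow> w \<in> c0 \<Longrightarrow>
    T z w = (\<Sum>i=1..2. \<Sum>j=1..2. complex_of_real (a i j) * coord z i * coord w j)"
    and le: "\<And>t. \<bar>t\<bar> \<le> 1 \<Longrightarrow> f t \<le> M"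
    and attained: "\<bar>s\<bar> \<le> 1" "f s = M"
  shows "bilinear_norm T = M"
proof -
  \<comment> \<open>\<open>L j\<close> is the coefficient of the \<open>j\<close>-th entry of
    \<open>w\<close>, formed from column \<open>j\<close> of the matrix.\<close>
  define L where "L = (\<lambda>j z1 z2. of_real (a 1 j) * z1 + of_real (a 2 j) * z2 :: complex)"
  have T': "T z w = L 1 (coord z 1) (coord z 2) * coord w 1 + L 2 (coord z 1) (coord z 2) * coord w 2"
    if "z \<in> c0" "w \<in> c0" for z w
    using T[OF that] by (simp add: L_def numeral_2_eq_2 algebra_simps)
  have unit: "cmod (L 1 u v) + cmod (L 2 u v) = f (Re (u * cnj v))"
    if "cmod u = 1" "cmod v = 1" for u v
    unfolding L_def f_def using cmod_real_combination_unit[OF that] by simp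
  have coord_le: "cmod (coord z n) \<le> 1" if "norm z \<le> 1" for z n
    using norm_bounded[of z "n - 1"] that by (simp add: coord_def)
  have upper: "cmod (T z w) \<le> M" if "z \<in> c0" "w \<in> c0" "norm z \<le> 1" "norm w \<le> 1" for z w
  proof -
    let ?L = "\<lambda>j. L j (coord z 1) (coord z 2)"
    have "cmod (L 1 u v) + cmod (L 2 u v) \<le> M" if "cmod u = 1" "cmod v = 1" for u v
    proof -
      have "\<bar>Re (u * cnj v)\<bar> \<le> cmod (u * cnj v)" by (rule abs_Re_le_cmod)
      then show ?thesis using unit[OF that] le that by (simp add: norm_mult)
    qed
    then have "cmod (?L 1) + cmod (?L 2) \<le> M"
      unfolding L_def by (rule cmod_sum_le_on_unit_bidisc[OF _ coord_le[OF that(3)] coord_le[OF that(3)]])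
    moreover have "cmod (?L 1 * coord w 1) \<le> cmod (?L 1)" "cmod (?L 2 * coord w 2) \<le> cmod (?L 2)"
      using coord_le[OF that(4)] by (simp_all add: norm_mult mult_left_le)
    ultimately show ?thesis
      unfolding T'[OF that(1,2)] using norm_triangle_ineq[of "?L 1 * coord w 1" "?L 2 * coord w 2"]
      by linarith
  qed
  have "\<exists>z w. M = cmod (T z w) \<and> z \<in> c0 \<and> w \<in> c0 \<and> norm z \<le> 1 \<and> norm w \<le> 1"
  proof -
    \<comment> \<open>A unimodular number with real part \<open>s\<close>: the pair
      \<open>u\<close>, 1 realises the parameter value \<open>s\<close>.\<close>
    define u where "u = Complex s (sqrt (1 - s\<^sup>2))"
    have "s\<^sup>2 \<le> 1" using attained(1) by (simp add: abs_square_le_1)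
    then have u: "cmod u = 1" by (simp add: u_def cmod_def)
    obtain z where z: "z \<in> c0" "norm z \<le> 1" "coord z 1 = u" "coord z 2 = 1"
      using c0_unit_ball_witness[of u 1] u by auto
    obtain e1 where e1: "cmod e1 = 1" "L 1 u 1 * e1 = of_real (cmod (L 1 u 1))"
      using rotation_to_cmod .
    obtain e2 where e2: "cmod e2 = 1" "L 2 u 1 * e2 = of_real (cmod (L 2 u 1))"
      using rotation_to_cmod .
    obtain w where w: "w \<in> c0" "norm w \<le> 1" "coord w 1 = e1" "coord w 2 = e2"
      using c0_unit_ball_witness[of e1 e2] e1 e2 by auto
    have "T z w = of_real (cmod (L 1 u 1) + cmod (L 2 u 1))"
      using T'[OF z(1) w(1)] z w e1 e2 by simp
    also have "cmod (L 1 u 1) + cmod (L 2 u 1) = M"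
      using unit[OF u, of 1] attained by (simp add: u_def)
    finally have "T z w = of_real M" .
    moreover have "M \<ge> 0" using \<open>cmod (L 1 u 1) + cmod (L 2 u 1) = M\<close> by (metis add_nonneg_nonneg norm_ge_zero)
    ultimately have "M = cmod (T z w)" by simp
    then show ?thesis using z w by blast
  qed
  then show ?thesis
    unfolding bilinear_norm_def using upper by (intro cSup_eq_maximum) auto
qed

section \<open>Translation to the coefficients of the form\<close>

lemma abs_two_mult_le_sum_squares:
  fixes x y :: real
  shows "\<bar>2 * x * y\<bar> \<le> x\<^sup>2 + y\<^sup>2"
proof -
  have "0 \<le> (x + y)\<^sup>2" "0 \<le> (x - y)\<^sup>2" by simp_all
  then show ?thesis by (simp add: power2_sum power2_diff abs_le_iff)
qed

theorem proposition2p1: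
  fixes a :: "nat \<Rightarrow> nat \<Rightarrow> real"
    and T :: "(nat \<Rightarrow>\<^sub>C complex) \<Rightarrow> (nat \<Rightarrow>\<^sub>C complex) \<Rightarrow> complex"
  assumes T: "\<And>z w. z \<in> c0 \<Longrightarrow> w \<in> c0 \<Longrightarrow>
    T z w = (\<Sum>i=1..2. \<Sum>j=1..2. complex_of_real (a i j) * coord z i * coord w j)"
  shows "let
      hypA = (a 1 1 \<noteq> 0 \<and> a 2 1 \<noteq> 0 \<and> a 1 2 \<noteq> 0 \<and> a 2 2 \<noteq> 0 \<and>
        sgn ((a 1 1 * a 2 1) / (a 1 2 * a 2 2)) = -1 \<and>
        \<bar>((a 1 1)\<^sup>2 * (a 2 1)\<^sup>2) / ((a 1 2)\<^sup>2 * (a 2 2)\<^sup>2) * ((a 1 2)\<^sup>2 + (a 2 2)\<^sup>2)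
            - ((a 1 1)\<^sup>2 + (a 2 1)\<^sup>2)\<bar>
          \<le> \<bar>2 * a 1 1 * a 2 1 * (1 - (a 1 1 * a 2 1) / (a 1 2 * a 2 2))\<bar>);
      \<kappa> = (((a 1 1)\<^sup>2 * (a 2 1)\<^sup>2) / ((a 1 2)\<^sup>2 * (a 2 2)\<^sup>2) * ((a 1 2)\<^sup>2 + (a 2 2)\<^sup>2)
            - ((a 1 1)\<^sup>2 + (a 2 1)\<^sup>2))
          / (2 * a 1 1 * a 2 1 * (1 - (a 1 1 * a 2 1) / (a 1 2 * a 2 2)))
    in
      (hypA \<longrightarrow> bilinear_norm T = Max {
          \<bar>a 1 1 + a 2 1\<bar> + \<bar>a 1 2 + a 2 2\<bar>,
          \<bar>a 1 1 - a 2 1\<bar> + \<bar>a 1 2 - a 2 2\<bar>,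
          sqrt ((a 1 1)\<^sup>2 + (a 2 1)\<^sup>2 + 2 * a 1 1 * a 2 1 * \<kappa>)
            + sqrt ((a 1 2)\<^sup>2 + (a 2 2)\<^sup>2 + 2 * a 1 2 * a 2 2 * \<kappa>)}) \<and>
      (\<not> hypA \<longrightarrow> bilinear_norm T = Max {
          \<bar>a 1 1 + a 2 1\<bar> + \<bar>a 1 2 + a 2 2\<bar>,
          \<bar>a 1 1 - a 2 1\<bar> + \<bar>a 1 2 - a 2 2\<bar>})"
proof -
  define P Q p q where "P = (a 1 1)\<^sup>2 + (a 2 1)\<^sup>2" and "Q = (a 1 2)\<^sup>2 + (a 2 2)\<^sup>2"
    and "p = 2 * a 1 1 * a 2 1" and "q = 2 * a 1 2 * a 2 2"
  define f where "f = (\<lambda>t. sqrt (P + p * t) + sqrt (Q + q * t))"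
  have pP: "\<bar>p\<bar> \<le> P" and qQ: "\<bar>q\<bar> \<le> Q"
    unfolding P_def Q_def p_def q_def by (rule abs_two_mult_le_sum_squares)+
  have ratio: "(a 1 1 * a 2 1) / (a 1 2 * a 2 2) = p / q"
    unfolding p_def q_def by simp
  have ratio2: "((a 1 1)\<^sup>2 * (a 2 1)\<^sup>2) / ((a 1 2)\<^sup>2 * (a 2 2)\<^sup>2) = (p / q)\<^sup>2"
    unfolding ratio[symmetric] by (simp add: power_mult_distrib power_divide)
  \<comment> \<open>At the endpoints 1 and -1 the radicands are perfect squares.\<close>
  have f1: "\<bar>a 1 1 + a 2 1\<bar> + \<bar>a 1 2 + a 2 2\<bar> = f 1"
    unfolding f_def P_def Q_def p_def q_def by (simp flip: real_sqrt_abs add: power2_sum)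
  have f2: "\<bar>a 1 1 - a 2 1\<bar> + \<bar>a 1 2 - a 2 2\<bar> = f (- 1)"
    unfolding f_def P_def Q_def p_def q_def by (simp flip: real_sqrt_abs add: power2_diff)
  have f3: "sqrt ((a 1 1)\<^sup>2 + (a 2 1)\<^sup>2 + 2 * a 1 1 * a 2 1 * t)
      + sqrt ((a 1 2)\<^sup>2 + (a 2 2)\<^sup>2 + 2 * a 1 2 * a 2 2 * t) = f t" for t
    unfolding f_def P_def Q_def p_def q_def by simp
  \<comment> \<open>\<open>N\<close> and \<open>D\<close> are the numerator and denominator of
    \<kappa>, so for nonzero \<open>D\<close> the inequality of case (A) says that \<kappa> lies in
    [-1, 1].\<close>
  define N where "N = (p / q)\<^sup>2 * Q - P"
  define D where "D = p * (1 - p / q)"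
  have norm_eq: "bilinear_norm T = Max (f ` S)"
    if S: "finite S" "S \<noteq> {}" "S \<subseteq> {-1..1}" "\<And>t. \<bar>t\<bar> \<le> 1 \<Longrightarrow> f t \<le> Max (f ` S)" for S
  proof -
    have "Max (f ` S) \<in> f ` S" using S by (intro Max_in) auto
    then obtain s where "s \<in> S" "f s = Max (f ` S)" by auto
    moreover have "\<bar>s\<bar> \<le> 1" using subsetD[OF S(3) \<open>s \<in> S\<close>] by auto
    ultimately show ?thesis
      using S(4) unfolding f_def P_def Q_def p_def q_def
      by (intro bilinear_norm_eqI[where a = a and s = s, OF T]) auto
  qed
  have nz: "p \<noteq> 0 \<and> q \<noteq> 0 \<longleftrightarrow> a 1 1 \<noteq> 0 \<and> a 2 1 \<noteq> 0 \<and> a 1 2 \<noteq> 0 \<and> a 2 2 \<noteq> 0"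
    unfolding p_def q_def by auto
  have sgn_iff: "sgn (p / q) = - 1 \<longleftrightarrow> p * q < 0"
    by (auto simp: sgn_if divide_less_0_iff mult_less_0_iff zero_less_divide_iff)
  \<comment> \<open>Clearing \<open>q^2\<close> turns the comparison of \<open>N\<close> with
    \<open>D\<close> into that of constant term and slope of the affine function giving the sign of
    the derivative; its zero is therefore \<open>N / D\<close>.\<close>
  have scale: "p\<^sup>2 * Q - q\<^sup>2 * P = q\<^sup>2 * N" "p * q * (p - q) = - (q\<^sup>2 * D)" if "q \<noteq> 0"
    using that unfolding N_def D_def by (simp_all add: field_simps power2_eq_square)
  have caseA: "bilinear_norm T = Max {f 1, f (- 1), f (N / D)}" if pq: "p * q < 0" and ND: "\<bar>N\<bar> \<le> \<bar>D\<bar>"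
  proof -
    have q: "q \<noteq> 0" and "p \<noteq> 0" and "p \<noteq> q" using pq by (auto simp: not_less[symmetric])
    then have D: "D \<noteq> 0" by (simp add: D_def)
    have \<kappa>: "\<bar>N / D\<bar> \<le> 1" using ND D by (simp add: abs_divide)
    have "p\<^sup>2 * (Q + q * (N / D)) - q\<^sup>2 * (P + p * (N / D))
        = (p\<^sup>2 * Q - q\<^sup>2 * P) + p * q * (p - q) * (N / D)"
      by algebra
    also have "\<dots> = 0" using D unfolding scale[OF q] by simp
    finally have crit: "p\<^sup>2 * (Q + q * (N / D)) = q\<^sup>2 * (P + p * (N / D))" by simp
    have "f t \<le> f (N / D)" if "\<bar>t\<bar> \<le> 1" for t
      unfolding f_def by (rule sqrt_sum_le_critical_value[OF pq pP qQ \<kappa> that crit])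
    then have "f t \<le> Max (f ` {1, -1, N / D})" if "\<bar>t\<bar> \<le> 1" for t
      using that by (auto simp: Max_ge_iff)
    then have "bilinear_norm T = Max (f ` {1, -1, N / D})"
      using abs_le_D1[OF \<kappa>] abs_le_D2[OF \<kappa>] by (intro norm_eq) auto
    then show ?thesis by simp
  qed
  have caseB: "bilinear_norm T = Max {f 1, f (- 1)}" if "\<not> (p * q < 0 \<and> \<bar>N\<bar> \<le> \<bar>D\<bar>)"
  proof -
    have nocrit: "\<bar>p * q * (p - q)\<bar> < \<bar>p\<^sup>2 * Q - q\<^sup>2 * P\<bar>" if pq: "p * q < 0"
    proof -
      have q: "q \<noteq> 0" using pq by auto
      have "\<bar>D\<bar> < \<bar>N\<bar>" using pq \<open>\<not> (p * q < 0 \<and> \<bar>N\<bar> \<le> \<bar>D\<bar>)\<close> by simp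
      then show ?thesis unfolding scale[OF q] using q by (simp add: abs_mult)
    qed
    have "f t \<le> Max (f ` {1, -1})" if "\<bar>t\<bar> \<le> 1" for t
      using sqrt_sum_le_endpoints[OF pP qQ that nocrit] unfolding f_def by (simp add: max_def)
    then have "bilinear_norm T = Max (f ` {1, -1})"
      by (intro norm_eq) auto
    then show ?thesis by simp
  qed
  have hyp: "(a 1 1 \<noteq> 0 \<and> a 2 1 \<noteq> 0 \<and> a 1 2 \<noteq> 0 \<and> a 2 2 \<noteq> 0 \<and>
        sgn (p / q) = - 1 \<and> \<bar>N\<bar> \<le> \<bar>D\<bar>) \<longleftrightarrow> p * q < 0 \<and> \<bar>N\<bar> \<le> \<bar>D\<bar>"
    using nz sgn_iff by auto
  show ?thesis
    unfolding Let_def ratio ratio2 f1 f2 f3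
    unfolding P_def[symmetric] Q_def[symmetric] p_def[symmetric] q_def[symmetric]
    unfolding N_def[symmetric] D_def[symmetric] hyp
    by (intro conjI impI caseA caseB) simp_all
qed

end
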